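(* Let $N$ be any positive integer. For the $N\times N\times N$ Latin cube over $\mathbb{Z}/N\mathbb{Z}$ formed by the Cayley addition table (the cube whose cells are indexed by the triples $(a,b,c)\in(\mathbb{Z}/N\mathbb{Z})^3$, the cell $(a,b,c)$ having entry $a+b+c$), each $n\times n\times n$ subcube with $1\le n\le N$ contains a Latin transversal.
   Context: An $n\times n\times n$ cube has cells indexed by triples of coordinates, each coordinate ranging over an index set of size $n$. A line of the cube is a set of $n$ cells obtained by fixing two of the three coordinates and letting the remaining one vary (analogous to a row or column of a matrix). A Latin cube over a set $S$ of cardinality $n$ is an $n\times n\times n$ cube whose entries come from $S$ and no line of which contains a repeated element. An $n\times n\times n$ subcube of an $N\times N\times N$ cube is obtained by restricting each of the three coordinates to a subset of size $n$ of its index set (the three subsets may be different); its lines are those of it regarded as an $n\times n\times n$ cube. A transversal of an $n\times n\times n$ cube is a collection of $n$ cells no two of which lie in the same line. A Latin transversal of a cube is a transversal whose cells contain no repeated element (i.e. the $n$ entries are pairwise distinct). *)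

theory Defs
  imports "HOL-Algebra.Algebra"
begin

text \<open>
  The cells of the cube with index sets \<open>A\<close>, \<open>B\<close>, \<open>C\<close> are the triples in \<open>A \<times> B \<times> C\<close>; its entries are
  given by a function on triples. A subcube keeps the entry function and shrinks the index sets,
  so its lines are the lines over the smaller index sets.
\<close>

definition cube_index :: "nat \<Rightarrow> 'a set \<Rightarrow> 'b set \<Rightarrow> 'c set \<Rightarrow> bool" where
  "cube_index n A B C \<longleftrightarrow>
     finite A \<and> finite B \<and> finite C \<and> card A = n \<and> card B = n \<and> card C = n"

definition cube_lines :: "'a set \<Rightarrow> 'b set \<Rightarrow> 'c set \<Rightarrow> ('a \<times> 'b \<times> 'c) set set" where
  "cube_lines A B C =
     {A \<times> {b} \<times> {c} | b c. b \<in> B \<and> c \<in> C}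
   \<union> {{a} \<times> B \<times> {c} | a c. a \<in> A \<and> c \<in> C}
   \<union> {{a} \<times> {b} \<times> C | a b. a \<in> A \<and> b \<in> B}"

definition latin_cube ::
    "nat \<Rightarrow> 's set \<Rightarrow> 'a set \<Rightarrow> 'b set \<Rightarrow> 'c set \<Rightarrow> ('a \<times> 'b \<times> 'c \<Rightarrow> 's) \<Rightarrow> bool" where
  "latin_cube n S A B C f \<longleftrightarrow>
     cube_index n A B C \<and> finite S \<and> card S = n \<and> f ` (A \<times> B \<times> C) \<subseteq> S \<and>
     (\<forall>L \<in> cube_lines A B C. inj_on f L)"

definition is_subcube ::
    "nat \<Rightarrow> 'a set \<Rightarrow> 'b set \<Rightarrow> 'c set \<Rightarrow> 'a set \<Rightarrow> 'b set \<Rightarrow> 'c set \<Rightarrow> bool" where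
  "is_subcube n A' B' C' A B C \<longleftrightarrow>
     A' \<subseteq> A \<and> B' \<subseteq> B \<and> C' \<subseteq> C \<and> cube_index n A' B' C'"

text \<open>
  Two distinct cells of a transversal may share one coordinate, but not two: only cells
  on a common line are excluded.
\<close>

definition cube_transversal ::
    "nat \<Rightarrow> 'a set \<Rightarrow> 'b set \<Rightarrow> 'c set \<Rightarrow> ('a \<times> 'b \<times> 'c) set \<Rightarrow> bool" where
  "cube_transversal n A B C T \<longleftrightarrow>
     T \<subseteq> A \<times> B \<times> C \<and> finite T \<and> card T = n \<and>
     (\<forall>x \<in> T. \<forall>y \<in> T. x \<noteq> y \<longrightarrow> \<not> (\<exists>L \<in> cube_lines A B C. x \<in> L \<and> y \<in> L))"

definition latin_transversal ::
    "nat \<Rightarrow> 'a set \<Rightarrow> 'b set \<Rightarrow> 'c set \<Rightarrow> ('a \<times> 'b \<times> 'c \<Rightarrow> 's) \<Rightarrow> ('a \<times> 'b \<times> 'c) set \<Rightarrow> bool" where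
  "latin_transversal n A B C f T \<longleftrightarrow> cube_transversal n A B C T \<and> inj_on f T"

text \<open>
  The group \<open>integer_mod_group N\<close> is the additive group of integers modulo \<open>N\<close>, so its
  multiplicatively written operation is addition modulo \<open>N\<close>. For \<open>N > 0\<close> its carrier
  is \<open>{0..<int N}\<close>; for \<open>N = 0\<close> it would be the infinite group of all integers.
\<close>

definition cayley_cube :: "nat \<Rightarrow> int \<times> int \<times> int \<Rightarrow> int" where
  "cayley_cube N = (\<lambda>(a, b, c).
     a \<otimes>\<^bsub>integer_mod_group N\<^esub> b \<otimes>\<^bsub>integer_mod_group N\<^esub> c)"

lemma latin_cube_cayley_cube:
  assumes "N \<ge> 1"
  defines "Z \<equiv> carrier (integer_mod_group N)"
  shows "latin_cube N Z Z Z Z (cayley_cube N)"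
proof -
  interpret comm_group "integer_mod_group N" by simp
  have "finite Z" "card Z = N"
    using assms by (auto simp: carrier_integer_mod_group)
  then show ?thesis
    unfolding latin_cube_def cube_index_def
    by (auto simp: cube_lines_def inj_on_def cayley_cube_def Z_def
        simp del: mult_integer_mod_group)
qed

end

theory Submission
  imports Defs "HOL.Complex" "Jordan_Normal_Form.Determinant"
begin

text \<open>
  The map \<open>k \<mapsto> \<omega> ^ k\<close> with \<open>\<omega>\<close> a primitive \<open>N\<close>-th root of unity embeds the integers modulo \<open>N\<close>
  into the multiplicative group of the complex numbers. Numbering the index sets and writing
  \<open>a\<close>, \<open>b\<close>, \<open>c\<close> for the embedded sequences, one expands
  \<open>\<Sum>\<sigma> \<tau>. sgn \<sigma> * sgn \<tau> * V (a i * b (\<sigma> i) * c (\<tau> i)) = V a * V b * V c\<close>, where \<open>V\<close> is the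
  Vandermonde determinant. The right side is nonzero, hence so is some determinant on the left, and
  its nodes \<open>a i * b (\<sigma> i) * c (\<tau> i)\<close> are pairwise distinct.
\<close>

text \<open>The sum is the Leibniz expansion of the determinant of the transpose of \<open>B\<close>
  with its rows permuted by \<open>p\<close>. Transposing leaves the determinant alone, and the
  permutation contributes the sign.\<close>

lemma sum_permutes_signof_prod:
  fixes B :: "'a :: comm_ring_1 mat"
  assumes B: "B \<in> carrier_mat n n" and p: "p permutes {0..<n}"
  shows "(\<Sum>s | s permutes {0..<n}. signof s * (\<Prod>i=0..<n. B $$ (s i, p i))) = signof p * det B"
proof -
  let ?M = "mat n n (\<lambda>(i, j). B\<^sup>T $$ (p i, j))"
  have M: "?M $$ (i, s i) = B $$ (s i, p i)" if "s permutes {0..<n}" "i \<in> {0..<n}" for s i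
    using that B permutes_in_image[OF that(1), of i] permutes_in_image[OF p, of i] by auto
  have "(\<Sum>s | s permutes {0..<n}. signof s * (\<Prod>i=0..<n. B $$ (s i, p i))) = det ?M"
    unfolding det_def'[of ?M n, simplified]
    by (intro sum.cong refl arg_cong2[where f = "(*)"] prod.cong) (use M in auto)
  also have "\<dots> = signof p * det B\<^sup>T"
    by (rule det_permute_rows) (use B p in auto)
  finally show ?thesis
    using det_transpose[OF B] by simp
qed

text \<open>Expand each inner determinant by the Leibniz formula over \<open>p\<close>. For fixed
  \<open>p\<close> the sums over \<open>s\<close> and \<open>t\<close> separate, and the previous
  lemma evaluates each of them; the remaining sum over \<open>p\<close> is the Leibniz formula for
  \<open>A\<close>.\<close>

lemma sum_signof_det_triple_product:
  fixes A B C :: "'a :: comm_ring_1 mat"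
  assumes A: "A \<in> carrier_mat n n" and B: "B \<in> carrier_mat n n" and C: "C \<in> carrier_mat n n"
  shows "(\<Sum>s | s permutes {0..<n}. \<Sum>t | t permutes {0..<n}. signof s * signof t *
            det (mat n n (\<lambda>(i, j). A $$ (i, j) * B $$ (s i, j) * C $$ (t i, j))))
         = det A * det B * det C" (is "(\<Sum>s\<in>?P. \<Sum>t\<in>?P. _) = _")
proof -
  define a where "a p = (\<Prod>i=0..<n. A $$ (i, p i))" for p
  define b where "b s p = signof s * (\<Prod>i=0..<n. B $$ (s i, p i))" for s p
  define c where "c t p = signof t * (\<Prod>i=0..<n. C $$ (t i, p i))" for t p
  have expand: "signof s * signof t *
      det (mat n n (\<lambda>(i, j). A $$ (i, j) * B $$ (s i, j) * C $$ (t i, j)))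
      = (\<Sum>p\<in>?P. signof p * a p * b s p * c t p)" for s t
  proof -
    have "(\<Prod>i=0..<n. mat n n (\<lambda>(i, j). A $$ (i, j) * B $$ (s i, j) * C $$ (t i, j)) $$ (i, p i))
        = a p * (\<Prod>i=0..<n. B $$ (s i, p i)) * (\<Prod>i=0..<n. C $$ (t i, p i))"
      if "p \<in> ?P" for p
    proof -
      have "p i < n" if "i < n" for i
        using permutes_in_image[of p "{0..<n}" i] \<open>p \<in> ?P\<close> that by auto
      then show ?thesis
        by (auto simp: a_def prod.distrib[symmetric] intro!: prod.cong)
    qed
    then show ?thesis
      by (subst det_def'[of _ n]) (auto simp: sum_distrib_left b_def c_def mult_ac intro!: sum.cong)
  qed
  \<comment> \<open>One sign comes from the expansion and one from each of \<open>B\<close> and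
    \<open>C\<close>. As signs square to 1, exactly the one needed for \<open>det A\<close>
    survives.\<close>
  have sign: "signof p * (signof p * x) * (signof p * y) = signof p * (x * y)" for p and x y :: 'a
    by (auto simp: sign_def)
  \<comment> \<open>With \<open>p\<close> outermost, the summand splits into a factor depending on
    \<open>s\<close> and one depending on \<open>t\<close>.\<close>
  have "(\<Sum>s\<in>?P. \<Sum>t\<in>?P. \<Sum>p\<in>?P. signof p * a p * b s p * c t p)
      = (\<Sum>s\<in>?P. \<Sum>p\<in>?P. \<Sum>t\<in>?P. signof p * a p * b s p * c t p)"
    by (intro sum.cong refl sum.swap)
  also have "\<dots> = (\<Sum>p\<in>?P. \<Sum>s\<in>?P. \<Sum>t\<in>?P. signof p * a p * b s p * c t p)"
    by (rule sum.swap)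
  also have "\<dots> = (\<Sum>p\<in>?P. a p * (signof p * (\<Sum>s\<in>?P. b s p) * (\<Sum>t\<in>?P. c t p)))"
    by (intro sum.cong refl) (simp add: sum_distrib_left sum_distrib_right mult_ac)
  also have "\<dots> = (\<Sum>p\<in>?P. a p * (signof p * (det B * det C)))"
    by (intro sum.cong refl)
      (simp add: b_def c_def sum_permutes_signof_prod[OF B] sum_permutes_signof_prod[OF C] sign)
  also have "\<dots> = det A * det B * det C"
    by (simp add: det_def'[OF A] a_def sum_distrib_left mult_ac)
  finally show ?thesis
    by (simp add: expand)
qed

text \<open>Nodes index the rows, so permuting rows permutes nodes, and applying the matrix to a
  coefficient vector evaluates that polynomial at every node.\<close>

definition vandermonde_mat :: "nat \<Rightarrow> (nat \<Rightarrow> 'a :: comm_ring_1) \<Rightarrow> 'a mat" where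
  "vandermonde_mat n x = mat n n (\<lambda>(i, j). x i ^ j)"

lemma vandermonde_mat_carrier [simp]: "vandermonde_mat n x \<in> carrier_mat n n"
  by (simp add: vandermonde_mat_def)

text \<open>Equal nodes give equal rows. Conversely, a null vector is the coefficient list of a
  nonzero polynomial of degree below \<open>n\<close> that vanishes at all nodes, which is
  impossible for \<open>n\<close> distinct nodes.\<close>

lemma det_vandermonde_mat_eq_0_iff:
  fixes x :: "nat \<Rightarrow> 'a :: idom"
  shows "det (vandermonde_mat n x) = 0 \<longleftrightarrow> \<not> inj_on x {0..<n}"
proof
  assume "\<not> inj_on x {0..<n}"
  then obtain i j where ij: "i \<noteq> j" "i < n" "j < n" "x i = x j"
    by (auto simp: inj_on_def)
  then have "row (vandermonde_mat n x) i = row (vandermonde_mat n x) j"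
    by (auto simp: vandermonde_mat_def)
  with ij show "det (vandermonde_mat n x) = 0"
    by (intro det_identical_rows[of _ n i j]) auto
next
  assume "det (vandermonde_mat n x) = 0"
  then obtain v where v: "v \<in> carrier_vec n" "v \<noteq> 0\<^sub>v n"
    and null: "vandermonde_mat n x *\<^sub>v v = 0\<^sub>v n"
    using det_0_iff_vec_prod_zero[of "vandermonde_mat n x" n] by auto
  define p where "p = (\<Sum>j<n. monom (v $ j) j)"
  have coeff: "coeff p j = (if j < n then v $ j else 0)" for j
    by (auto simp: p_def coeff_sum)
  obtain j where j: "j < n" "v $ j \<noteq> 0"
    using v by (auto simp: vec_eq_iff)
  then have "p \<noteq> 0"
    using coeff[of j] by auto
  have deg: "degree p < n"
    by (rule degree_lessI) (use \<open>p \<noteq> 0\<close> coeff in auto)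
  have "poly p (x i) = 0" if "i < n" for i
  proof -
    have "poly p (x i) = (vandermonde_mat n x *\<^sub>v v) $ i"
      using that v(1)
      by (simp add: p_def vandermonde_mat_def scalar_prod_def poly_sum poly_monom
          lessThan_atLeast0 mult_ac)
    then show ?thesis
      using null that by simp
  qed
  then have sub: "x ` {0..<n} \<subseteq> {z. poly p z = 0}"
    by auto
  show "\<not> inj_on x {0..<n}"
  proof
    assume "inj_on x {0..<n}"
    then have "n \<le> card {z. poly p z = 0}"
      using card_mono[OF poly_roots_finite[OF \<open>p \<noteq> 0\<close>] sub] by (simp add: card_image)
    with card_poly_roots_bound[OF \<open>p \<noteq> 0\<close>] deg show False
      by simp
  qed
qed

lemma exists_permutes_inj_on_triple_product:
  fixes a b c :: "nat \<Rightarrow> 'a :: idom"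
  assumes "inj_on a {0..<n}" "inj_on b {0..<n}" "inj_on c {0..<n}"
  obtains s t where "s permutes {0..<n}" "t permutes {0..<n}"
    "inj_on (\<lambda>i. a i * b (s i) * c (t i)) {0..<n}"
proof -
  let ?P = "{s. s permutes {0..<n}}"
  let ?V = "vandermonde_mat n"
  \<comment> \<open>Powers are multiplicative, so the entrywise product of Vandermonde matrices is
    again one, whose nodes are the products.\<close>
  have "mat n n (\<lambda>(i, j). ?V a $$ (i, j) * ?V b $$ (s i, j) * ?V c $$ (t i, j))
      = ?V (\<lambda>i. a i * b (s i) * c (t i))" if "s \<in> ?P" "t \<in> ?P" for s t
  proof -
    have "s i < n" "t i < n" if "i < n" for i
      using permutes_in_image[of s "{0..<n}" i] permutes_in_image[of t "{0..<n}" i]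
        \<open>s \<in> ?P\<close> \<open>t \<in> ?P\<close> that by auto
    then show ?thesis
      by (auto simp: vandermonde_mat_def power_mult_distrib)
  qed
  then have "(\<Sum>s\<in>?P. \<Sum>t\<in>?P. signof s * signof t * det (?V (\<lambda>i. a i * b (s i) * c (t i))))
      = det (?V a) * det (?V b) * det (?V c)"
    using sum_signof_det_triple_product[of "?V a" n "?V b" "?V c"] by simp
  also have "\<dots> \<noteq> 0"
    using assms by (simp add: det_vandermonde_mat_eq_0_iff)
  finally obtain s where s: "s \<in> ?P"
    "(\<Sum>t\<in>?P. signof s * signof t * det (?V (\<lambda>i. a i * b (s i) * c (t i)))) \<noteq> 0"
    by (meson sum.not_neutral_contains_not_neutral)
  from s(2) obtain t where "t \<in> ?P" "det (?V (\<lambda>i. a i * b (s i) * c (t i))) \<noteq> 0"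
    by (auto elim!: sum.not_neutral_contains_not_neutral)
  with s(1) that show thesis
    by (auto simp: det_vandermonde_mat_eq_0_iff)
qed

lemma cayley_cube_eq_mod:
  "N > 0 \<Longrightarrow> cayley_cube N (a, b, c) = (a + b + c) mod int N"
  by (simp add: cayley_cube_def mod_add_left_eq)

text \<open>This moves the problem from addition modulo \<open>N\<close> to multiplication in a
  field, where the determinant argument applies.\<close>

lemma root_of_unity_character:
  assumes "N > 0"
  obtains e :: "int \<Rightarrow> complex" where "inj_on e (carrier (integer_mod_group N))"
    and "\<forall>a \<in> carrier (integer_mod_group N). \<forall>b \<in> carrier (integer_mod_group N).
         \<forall>c \<in> carrier (integer_mod_group N). e (cayley_cube N (a, b, c)) = e a * e b * e c"
proof
  define w where "w = cis (2 * pi / real N)"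
  have w_pow: "w ^ k = cis (2 * pi * real k / real N)" for k
    by (simp add: w_def DeMoivre mult_ac)
  have w_N: "w ^ N = 1"
    using assms by (simp add: w_pow)
  have w_mod: "w ^ (k mod N) = w ^ k" for k
  proof -
    have "w ^ k = w ^ (N * (k div N) + k mod N)" by simp
    also have "\<dots> = w ^ (k mod N)"
      by (simp only: power_add power_mult w_N power_one mult_1)
    finally show ?thesis by simp
  qed
  \<comment> \<open>This is primitivity of \<open>w\<close>: its first \<open>N\<close> powers are
    the \<open>N\<close> distinct roots of unity.\<close>
  have inj: "inj_on (\<lambda>k. w ^ k) {..<N}"
    using bij_betw_roots_unity[OF assms] by (simp add: bij_betw_def w_pow)
  \<comment> \<open>For positive \<open>N\<close> the residues are represented by the integers from
    0 to \<open>N - 1\<close>, on which \<open>nat\<close> loses nothing.\<close>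
  show "inj_on (\<lambda>k. w ^ nat k) (carrier (integer_mod_group N))"
  proof (rule inj_onI)
    fix x y
    assume xy: "x \<in> carrier (integer_mod_group N)" "y \<in> carrier (integer_mod_group N)"
      "w ^ nat x = w ^ nat y"
    then have "nat x = nat y"
      using assms by (intro inj_onD[OF inj]) (auto simp: carrier_integer_mod_group)
    with xy assms show "x = y"
      by (auto simp: carrier_integer_mod_group)
  qed
  have "w ^ nat (cayley_cube N (a, b, c)) = w ^ nat a * w ^ nat b * w ^ nat c"
    if "a \<in> carrier (integer_mod_group N)" "b \<in> carrier (integer_mod_group N)"
      "c \<in> carrier (integer_mod_group N)" for a b c
  proof -
    have nonneg: "a \<ge> 0" "b \<ge> 0" "c \<ge> 0"
      using that assms by (auto simp: carrier_integer_mod_group)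
    then have "nat (cayley_cube N (a, b, c)) = (nat a + nat b + nat c) mod N"
      using assms by (simp add: cayley_cube_eq_mod nat_mod_distrib nat_add_distrib)
    then show ?thesis
      by (simp add: w_mod power_add)
  qed
  then show "\<forall>a \<in> carrier (integer_mod_group N). \<forall>b \<in> carrier (integer_mod_group N).
      \<forall>c \<in> carrier (integer_mod_group N).
        w ^ nat (cayley_cube N (a, b, c)) = w ^ nat a * w ^ nat b * w ^ nat c"
    by blast
qed

theorem corollary1p1:
  fixes N n :: nat and A B C :: "int set"
  assumes "N \<ge> 1" and "1 \<le> n" and "n \<le> N"
    and "is_subcube n A B C
           (carrier (integer_mod_group N)) (carrier (integer_mod_group N))
           (carrier (integer_mod_group N))"
  shows "\<exists>T. latin_transversal n A B C (cayley_cube N) T"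
proof -
  let ?Z = "carrier (integer_mod_group N)"
  have sub: "A \<subseteq> ?Z" "B \<subseteq> ?Z" "C \<subseteq> ?Z"
    and fin: "finite A" "finite B" "finite C"
    and card: "card A = n" "card B = n" "card C = n"
    using assms(4) by (auto simp: is_subcube_def cube_index_def)
  obtain a b c where bij: "bij_betw a {0..<n} A" "bij_betw b {0..<n} B" "bij_betw c {0..<n} C"
    using ex_bij_betw_nat_finite[OF fin(1)] ex_bij_betw_nat_finite[OF fin(2)]
      ex_bij_betw_nat_finite[OF fin(3)] unfolding card by blast
  have "N > 0"
    using assms(1) by simp
  then obtain e :: "int \<Rightarrow> complex" where e_inj: "inj_on e ?Z"
    and e_sum: "\<forall>a\<in>?Z. \<forall>b\<in>?Z. \<forall>c\<in>?Z. e (cayley_cube N (a, b, c)) = e a * e b * e c"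
    by (rule root_of_unity_character)
  \<comment> \<open>Injectivity of \<open>e\<close> makes the nodes taken from each index set
    distinct.\<close>
  have e_comp: "inj_on (\<lambda>i. e (f i)) {0..<n}" if "bij_betw f {0..<n} S" "S \<subseteq> ?Z" for f S
    using comp_inj_on[of f "{0..<n}" e] inj_on_subset[OF e_inj that(2)] that(1)
    unfolding bij_betw_def comp_def by blast
  obtain s t where perm: "s permutes {0..<n}" "t permutes {0..<n}"
    and inj: "inj_on (\<lambda>i. e (a i) * e (b (s i)) * e (c (t i))) {0..<n}"
    by (rule exists_permutes_inj_on_triple_product[OF e_comp[OF bij(1) sub(1)]
        e_comp[OF bij(2) sub(2)] e_comp[OF bij(3) sub(3)]])
  define cell where "cell i = (a i, b (s i), c (t i))" for i
  have bij': "bij_betw (\<lambda>i. b (s i)) {0..<n} B" "bij_betw (\<lambda>i. c (t i)) {0..<n} C"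
    using bij_betw_trans[OF permutes_imp_bij[OF perm(1)] bij(2)]
      bij_betw_trans[OF permutes_imp_bij[OF perm(2)] bij(3)] by (simp_all add: comp_def)
  have mem: "a i \<in> A" "b (s i) \<in> B" "c (t i) \<in> C" if "i \<in> {0..<n}" for i
    using that bij_betwE[OF bij(1)] bij_betwE[OF bij'(1)] bij_betwE[OF bij'(2)] by simp_all
  have coord: "a i = a j \<longleftrightarrow> i = j" "b (s i) = b (s j) \<longleftrightarrow> i = j" "c (t i) = c (t j) \<longleftrightarrow> i = j"
    if "i \<in> {0..<n}" "j \<in> {0..<n}" for i j
    using inj_on_eq_iff[OF bij_betw_imp_inj_on[OF bij(1)] that]
      inj_on_eq_iff[OF bij_betw_imp_inj_on[OF bij'(1)] that]
      inj_on_eq_iff[OF bij_betw_imp_inj_on[OF bij'(2)] that] by simp_all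
  have e_cell: "e (cayley_cube N (cell i)) = e (a i) * e (b (s i)) * e (c (t i))"
    if "i \<in> {0..<n}" for i
    using mem[OF that] sub e_sum unfolding cell_def by blast
  have "inj_on (cayley_cube N \<circ> cell) {0..<n}"
  proof (rule inj_onI)
    fix i j
    assume ij: "i \<in> {0..<n}" "j \<in> {0..<n}"
      and "(cayley_cube N \<circ> cell) i = (cayley_cube N \<circ> cell) j"
    \<comment> \<open>Equal entries have equal images under \<open>e\<close>, so distinctness of the
      products passes back to the entries.\<close>
    then have "e (cayley_cube N (cell i)) = e (cayley_cube N (cell j))"
      by simp
    then show "i = j"
      unfolding e_cell[OF ij(1)] e_cell[OF ij(2)] by (rule inj_onD[OF inj _ ij])
  qed
  then have inj_cube: "inj_on (cayley_cube N) (cell ` {0..<n})"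
    by (rule inj_on_imageI)
  have "inj_on cell {0..<n}"
    using coord by (auto simp: inj_on_def cell_def)
  then have "card (cell ` {0..<n}) = n"
    by (simp add: card_image)
  moreover have "cell ` {0..<n} \<subseteq> A \<times> B \<times> C"
    using mem by (auto simp: cell_def)
  moreover have "finite (cell ` {0..<n})"
    by simp
  moreover have "\<not> (\<exists>L \<in> cube_lines A B C. x \<in> L \<and> y \<in> L)"
    if cells: "x \<in> cell ` {0..<n}" "y \<in> cell ` {0..<n}" "x \<noteq> y" for x y
  proof -
    obtain i j where ij: "i \<in> {0..<n}" "j \<in> {0..<n}" and xy: "x = cell i" "y = cell j"
      using cells by blast
    have "i \<noteq> j"
      using cells(3) xy by blast
    \<comment> \<open>Two cells on a common line agree in two coordinates, but each coordinate runs
      bijectively through its index set, so distinct chosen cells agree in none.\<close>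
    then have "a i \<noteq> a j" "b (s i) \<noteq> b (s j)" "c (t i) \<noteq> c (t j)"
      unfolding coord[OF ij] by blast+
    then show ?thesis
      unfolding xy by (auto simp: cube_lines_def cell_def)
  qed
  ultimately have "latin_transversal n A B C (cayley_cube N) (cell ` {0..<n})"
    unfolding latin_transversal_def cube_transversal_def using inj_cube by blast
  then show ?thesis ..
qed

end
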